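(* Let $f(x,y)\in\mathbb{K}[[x,y]]$ be an irreducible formal power series having the Newton-Puiseux series relative to $x$ $$\eta(x^{1/n})=\tilde a^m\,x^{m/n}\left(1+\sum_{k>m}c_k\,x^{\frac{k-m}{n}}\right),$$ where $m,n\in\mathbb{N}^*$, $\tilde a\in\mathbb{K}^*$, $c_k\in\mathbb{K}$, this representation being primitive. Let $\xi(y^{1/m})\in\mathbb{K}[[y^{1/m}]]$ be the corresponding Newton-Puiseux series of $f$ relative to $y$ (corresponding to the choice of the $m$-th root $\tilde a$ of $\tilde a^m$). Then for every integer $q\ge n$, the coefficient $[\xi]_{q/m}$ of $y^{q/m}$ in $\xi(y^{1/m})$ is $$[\xi]_{\frac qm}=\frac nq\,\tilde a^{-q}\left[1+\sum_{i\ge1}\binom{-q/m}{i}\left(\sum_{s>m}c_s\,x^{\frac{s-m}{n}}\right)^i\right]_{-1+\frac qn}.$$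
   Context: $\mathbb{K}$ is an algebraically closed field of characteristic zero; $\mathbb{N}^*$ is the set of positive integers. $\mathbb{K}[[t]]^*$ is the set of formal power series with non-zero constant term. For a series $\psi$ with rational exponents, $[\psi]_r$ is the coefficient of the monomial of exponent $r$. For $r\in\mathbb{R}$ and $i\in\mathbb{N}^*$, $\binom ri=\frac{r(r-1)\cdots(r-i+1)}{i!}$. If $f\in\mathbb{K}[[x,y]]$ satisfies $\mathrm{ord}_y f(0,y)=N\in\mathbb{N}^*$, its Weierstrass polynomial relative to $x$ is the unique monic $F\in\mathbb{K}[[x]][y]$ of degree $N$ with $f=\epsilon F$, $\epsilon$ a unit of $\mathbb{K}[[x,y]]$; the Newton-Puiseux series of $f$ relative to $x$ are the roots of $F$ in $\bigcup_{k\ge1}\mathbb{K}[[x^{1/k}]]$. Those relative to $y$ are defined symmetrically. A representation $\psi=\eta(x^{1/n})$, with $\eta\in\mathbb{K}[[t]]$, is primitive if $n$ is the lowest common denominator of the exponents of $\psi$. Dual: if $\phi\in\mathbb{K}[[t]]^*$, its dual is the unique $\check{\phi}\in\mathbb{K}[[u]]^*$ such that $u\,\check{\phi}(u)$ and $t\,\phi(t)$ are inverse of each other for composition. Corresponding series: write $\eta(t)=(t\,\tilde\eta(t))^m$ where $\tilde\eta\in\mathbb{K}[[t]]^*$ is the unique such series with constant term $\tilde a$; let $\tilde\xi\in\mathbb{K}[[u]]^*$ be the dual of $\tilde\eta$ and put $\xi(u)=(u\,\tilde\xi(u))^n$. Then $\xi(y^{1/m})$ is a Newton-Puiseux series of $f$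 relative to $y$, called the one corresponding to $\eta(x^{1/n})$. *)

theory Defs
  imports "HOL-Computational_Algebra.Computational_Algebra"
begin

unbundle fps_syntax

section \<open>Puiseux series with nonnegative exponents\<close>

text \<open>
  The ring \<open>\<Union>k\<ge>1. K[[x\<^bsup>1/k\<^esup>]]\<close>. A series is represented by its coefficient function on the
  rational exponents; the exponents that occur have a common denominator.
\<close>

typedef (overloaded) 'a puiseux =
  "{\<psi> :: rat \<Rightarrow> 'a::zero. \<exists>k>0. \<forall>r. \<psi> r \<noteq> 0 \<longrightarrow> of_nat k * r \<in> \<nat>}"
  morphisms puiseux_nth Abs_puiseux
  by (rule exI[of _ "\<lambda>_. 0"]) auto

lemma puiseux_eqI: "(\<And>r. puiseux_nth \<psi> r = puiseux_nth \<phi> r) \<Longrightarrow> \<psi> = \<phi>"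
  by (metis puiseux_nth_inject ext)

text \<open>
  \<open>puiseux_of_fps k \<eta>\<close> is \<open>\<eta>(x\<^bsup>1/k\<^esup>)\<close>. It is meaningful only for \<open>k > 0\<close>.
\<close>

definition puiseux_of_fps :: "nat \<Rightarrow> 'a::zero fps \<Rightarrow> 'a puiseux" where
  "puiseux_of_fps k \<eta> =
     Abs_puiseux (\<lambda>r. if of_nat k * r \<in> \<nat> then \<eta> $ nat \<lfloor>of_nat k * r\<rfloor> else 0)"

lemma puiseux_nth_of_fps:
  assumes "k > 0"
  shows "puiseux_nth (puiseux_of_fps k \<eta>) r =
           (if of_nat k * r \<in> \<nat> then \<eta> $ nat \<lfloor>of_nat k * r\<rfloor> else 0)"
  unfolding puiseux_of_fps_def
  by (subst Abs_puiseux_inverse) (use assms in \<open>auto intro!: exI[of _ k]\<close>)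

lemma puiseux_nth_of_fps_frac:
  assumes "k > 0"
  shows "puiseux_nth (puiseux_of_fps k \<eta>) (of_nat i / of_nat k) = \<eta> $ i"
  using assms by (simp add: puiseux_nth_of_fps)

lemma puiseux_eq_of_fps:
  assumes "k > 0" "\<And>r. puiseux_nth \<psi> r \<noteq> 0 \<Longrightarrow> of_nat k * r \<in> \<nat>"
  shows "\<psi> = puiseux_of_fps k (Abs_fps (\<lambda>i. puiseux_nth \<psi> (of_nat i / of_nat k)))"
proof (rule puiseux_eqI)
  fix r
  show "puiseux_nth \<psi> r = puiseux_nth
          (puiseux_of_fps k (Abs_fps (\<lambda>i. puiseux_nth \<psi> (of_nat i / of_nat k)))) r"
  proof (cases "of_nat k * r \<in> \<nat>")
    case True
    then obtain i where "of_nat k * r = of_nat i" by (auto simp: Nats_def)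
    hence "r = of_nat i / of_nat k" using assms(1) by (simp add: field_simps)
    thus ?thesis using assms(1) by (simp add: puiseux_nth_of_fps)
  next
    case False
    thus ?thesis using assms by (auto simp: puiseux_nth_of_fps)
  qed
qed

lemma puiseux_denominator:
  obtains k where "k > 0" "\<And>r. puiseux_nth \<psi> r \<noteq> 0 \<Longrightarrow> of_nat k * r \<in> \<nat>"
  using puiseux_nth[of \<psi>] by auto

lemma puiseux_denominator_mult:
  fixes r :: rat
  assumes "of_nat k * r \<in> \<nat>"
  shows "of_nat (k * l) * r \<in> \<nat>"
proof -
  have "of_nat l * (of_nat k * r) \<in> \<nat>" by (intro Nats_mult assms) auto
  thus ?thesis by (simp add: mult_ac)
qed

lemma puiseux_common_denominator:
  obtains k a b c where "k > 0" "\<psi> = puiseux_of_fps k a" "\<phi> = puiseux_of_fps k b"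
    "\<chi> = puiseux_of_fps k c"
proof -
  obtain k1 where 1: "k1 > 0" "\<And>r. puiseux_nth \<psi> r \<noteq> 0 \<Longrightarrow> of_nat k1 * r \<in> \<nat>"
    using puiseux_denominator[of \<psi>] by blast
  obtain k2 where 2: "k2 > 0" "\<And>r. puiseux_nth \<phi> r \<noteq> 0 \<Longrightarrow> of_nat k2 * r \<in> \<nat>"
    using puiseux_denominator[of \<phi>] by blast
  obtain k3 where 3: "k3 > 0" "\<And>r. puiseux_nth \<chi> r \<noteq> 0 \<Longrightarrow> of_nat k3 * r \<in> \<nat>"
    using puiseux_denominator[of \<chi>] by blast
  define k where "k = k1 * k2 * k3"
  have k: "k > 0" "k = k1 * (k2 * k3)" "k = k2 * (k1 * k3)" "k = k3 * (k1 * k2)"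
    using 1 2 3 by (auto simp: k_def)
  show ?thesis
    by (rule that[OF k(1) puiseux_eq_of_fps puiseux_eq_of_fps puiseux_eq_of_fps])
       (use k 1(2) 2(2) 3(2) puiseux_denominator_mult in metis)+
qed

instantiation puiseux :: (comm_ring_1) comm_ring_1
begin

definition zero_puiseux :: "'a puiseux" where
  "0 = Abs_puiseux (\<lambda>_. 0)"

definition one_puiseux :: "'a puiseux" where
  "1 = Abs_puiseux (\<lambda>r. if r = 0 then 1 else 0)"

definition plus_puiseux :: "'a puiseux \<Rightarrow> 'a puiseux \<Rightarrow> 'a puiseux" where
  "\<psi> + \<phi> = Abs_puiseux (\<lambda>r. puiseux_nth \<psi> r + puiseux_nth \<phi> r)"

definition uminus_puiseux :: "'a puiseux \<Rightarrow> 'a puiseux" where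
  "- \<psi> = Abs_puiseux (\<lambda>r. - puiseux_nth \<psi> r)"

definition minus_puiseux :: "'a puiseux \<Rightarrow> 'a puiseux \<Rightarrow> 'a puiseux" where
  "\<psi> - \<phi> = Abs_puiseux (\<lambda>r. puiseux_nth \<psi> r - puiseux_nth \<phi> r)"

text \<open>The index set of the sum is finite.\<close>

definition times_puiseux :: "'a puiseux \<Rightarrow> 'a puiseux \<Rightarrow> 'a puiseux" where
  "\<psi> * \<phi> = Abs_puiseux (\<lambda>r.
     \<Sum>s | puiseux_nth \<psi> s \<noteq> 0 \<and> puiseux_nth \<phi> (r - s) \<noteq> 0. puiseux_nth \<psi> s * puiseux_nth \<phi> (r - s))"

lemma puiseux_of_fps_0: "k > 0 \<Longrightarrow> puiseux_of_fps k 0 = (0 :: 'a puiseux)"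
  unfolding puiseux_of_fps_def zero_puiseux_def
  by (intro arg_cong[of _ _ Abs_puiseux]) (auto simp: fun_eq_iff)

lemma puiseux_of_fps_1:
  assumes "k > 0"
  shows "puiseux_of_fps k 1 = (1 :: 'a puiseux)"
proof -
  have "(if of_nat k * r \<in> \<nat> then (1 :: 'a fps) $ nat \<lfloor>of_nat k * r\<rfloor> else 0) =
          (if r = 0 then 1 else 0)" for r :: rat
    using assms by (auto simp: Nats_def)
  thus ?thesis by (simp add: puiseux_of_fps_def one_puiseux_def)
qed

lemma puiseux_of_fps_add:
  assumes "k > 0"
  shows "puiseux_of_fps k a + puiseux_of_fps k b = (puiseux_of_fps k (a + b) :: 'a puiseux)"
  using assms unfolding plus_puiseux_def puiseux_of_fps_def[of k "a + b"]
  by (intro arg_cong[of _ _ Abs_puiseux]) (auto simp: puiseux_nth_of_fps fun_eq_iff)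

lemma puiseux_of_fps_diff:
  assumes "k > 0"
  shows "puiseux_of_fps k a - puiseux_of_fps k b = (puiseux_of_fps k (a - b) :: 'a puiseux)"
  using assms unfolding minus_puiseux_def puiseux_of_fps_def[of k "a - b"]
  by (intro arg_cong[of _ _ Abs_puiseux]) (auto simp: puiseux_nth_of_fps fun_eq_iff)

lemma puiseux_of_fps_uminus:
  assumes "k > 0"
  shows "- puiseux_of_fps k a = (puiseux_of_fps k (- a) :: 'a puiseux)"
  using assms unfolding uminus_puiseux_def puiseux_of_fps_def[of k "- a"]
  by (intro arg_cong[of _ _ Abs_puiseux]) (auto simp: puiseux_nth_of_fps fun_eq_iff)

lemma puiseux_of_fps_mult:
  assumes k: "k > 0"
  shows "puiseux_of_fps k a * puiseux_of_fps k b = (puiseux_of_fps k (a * b) :: 'a puiseux)"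
proof -
  let ?A = "puiseux_nth (puiseux_of_fps k a)" and ?B = "puiseux_nth (puiseux_of_fps k b)"
  have "(\<Sum>s | ?A s \<noteq> 0 \<and> ?B (r - s) \<noteq> 0. ?A s * ?B (r - s)) =
          (if of_nat k * r \<in> \<nat> then (a * b) $ nat \<lfloor>of_nat k * r\<rfloor> else 0)" for r
  proof (cases "of_nat k * r \<in> \<nat>")
    case True
    then obtain N where N: "of_nat k * r = of_nat N" by (auto simp: Nats_def)
    have r: "r = of_nat N / of_nat k" using N k by (simp add: field_simps)
    have diff: "r - of_nat i / of_nat k = of_nat (N - i) / of_nat k" if "i \<le> N" for i
      using that k by (simp add: r of_nat_diff field_simps)
    have inj: "inj_on (\<lambda>i. of_nat i / of_nat k :: rat) {0..N}"
      using k by (auto simp: inj_on_def)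
    have sub: "{s. ?A s \<noteq> 0 \<and> ?B (r - s) \<noteq> 0} \<subseteq> (\<lambda>i. of_nat i / of_nat k) ` {0..N}"
    proof
      fix s assume "s \<in> {s. ?A s \<noteq> 0 \<and> ?B (r - s) \<noteq> 0}"
      hence "of_nat k * s \<in> \<nat>" "of_nat k * (r - s) \<in> \<nat>"
        using k by (auto simp: puiseux_nth_of_fps split: if_splits)
      then obtain i j where ij: "of_nat k * s = of_nat i" "of_nat k * (r - s) = of_nat j"
        by (auto simp: Nats_def)
      have "(of_nat N :: rat) = of_nat (i + j)"
        using ij N by (simp add: algebra_simps)
      hence "i \<le> N" unfolding of_nat_eq_iff by simp
      moreover have "s = of_nat i / of_nat k" using ij k by (simp add: field_simps)
      ultimately show "s \<in> (\<lambda>i. of_nat i / of_nat k) ` {0..N}" by auto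
    qed
    have "(\<Sum>s | ?A s \<noteq> 0 \<and> ?B (r - s) \<noteq> 0. ?A s * ?B (r - s)) =
            (\<Sum>s\<in>(\<lambda>i. of_nat i / of_nat k) ` {0..N}. ?A s * ?B (r - s))"
      by (rule sum.mono_neutral_left) (use sub in auto)
    also have "\<dots> = (\<Sum>i=0..N. a $ i * b $ (N - i))"
      by (subst sum.reindex[OF inj])
         (auto intro!: sum.cong simp: diff puiseux_nth_of_fps_frac[OF k] simp del: of_nat_diff)
    finally show ?thesis using N by (simp add: fps_mult_nth)
  next
    case False
    have "{s. ?A s \<noteq> 0 \<and> ?B (r - s) \<noteq> 0} = {}"
    proof -
      have False if "?A s \<noteq> 0" "?B (r - s) \<noteq> 0" for s
      proof -
        have "of_nat k * s \<in> \<nat>" "of_nat k * (r - s) \<in> \<nat>"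
          using that k by (auto simp: puiseux_nth_of_fps split: if_splits)
        hence "of_nat k * s + of_nat k * (r - s) \<in> \<nat>" by (rule Nats_add)
        thus False using False by (simp add: algebra_simps)
      qed
      thus ?thesis by auto
    qed
    thus ?thesis using False by (simp only: sum.empty) simp
  qed
  thus ?thesis unfolding times_puiseux_def puiseux_of_fps_def[of k "a * b"] by simp
qed

lemmas puiseux_of_fps_hom =
  puiseux_of_fps_add puiseux_of_fps_diff puiseux_of_fps_uminus puiseux_of_fps_mult

instance
proof
  fix \<psi> \<phi> \<chi> :: "'a puiseux"
  obtain k a b c where k: "k > 0" and eq: "\<psi> = puiseux_of_fps k a" "\<phi> = puiseux_of_fps k b"
    "\<chi> = puiseux_of_fps k c" using puiseux_common_denominator .
  note [simp] = puiseux_of_fps_hom[OF k] puiseux_of_fps_0[OF k, symmetric]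
    puiseux_of_fps_1[OF k, symmetric]
  show "\<psi> * \<phi> * \<chi> = \<psi> * (\<phi> * \<chi>)" by (simp add: eq mult_ac)
  show "\<psi> * \<phi> = \<phi> * \<psi>" by (simp add: eq mult_ac)
  show "1 * \<psi> = \<psi>" by (simp add: eq)
  show "\<psi> + \<phi> + \<chi> = \<psi> + (\<phi> + \<chi>)" by (simp add: eq add_ac)
  show "\<psi> + \<phi> = \<phi> + \<psi>" by (simp add: eq add_ac)
  show "0 + \<psi> = \<psi>" by (simp add: eq)
  show "- \<psi> + \<psi> = 0" by (simp add: eq)
  show "\<psi> - \<phi> = \<psi> + - \<phi>" by (simp add: eq)
  show "(\<psi> + \<phi>) * \<chi> = \<psi> * \<chi> + \<phi> * \<chi>" by (simp add: eq algebra_simps)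
  show "(0 :: 'a puiseux) \<noteq> 1"
  proof
    assume "(0 :: 'a puiseux) = 1"
    hence "puiseux_nth (puiseux_of_fps k (0 :: 'a fps)) (of_nat 0 / of_nat k) =
           puiseux_nth (puiseux_of_fps k 1) (of_nat 0 / of_nat k)" by simp
    thus False unfolding puiseux_nth_of_fps_frac[OF k] by simp
  qed
qed

end

definition puiseux_exponents :: "'a::zero puiseux \<Rightarrow> rat set" where
  "puiseux_exponents \<psi> = {r. puiseux_nth \<psi> r \<noteq> 0}"

definition lowest_common_denominator :: "rat set \<Rightarrow> nat" where
  "lowest_common_denominator A = (LEAST k. k > 0 \<and> (\<forall>r\<in>A. of_nat k * r \<in> \<int>))"

definition primitive_rep :: "nat \<Rightarrow> 'a::zero fps \<Rightarrow> bool" where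
  "primitive_rep n \<eta> \<longleftrightarrow>
     n > 0 \<and> n = lowest_common_denominator (puiseux_exponents (puiseux_of_fps n \<eta>))"


section \<open>Newton-Puiseux series\<close>

text \<open>
  An element \<open>f\<close> of \<open>K[[x,y]]\<close> is represented as an element of \<open>K[[x]][[y]]\<close>: the coefficient of
  \<open>x\<^sup>i y\<^sup>j\<close> is \<open>f $ j $ i\<close>.
\<close>

definition fps_swap :: "'a fps fps \<Rightarrow> 'a fps fps" where
  "fps_swap f = Abs_fps (\<lambda>i. Abs_fps (\<lambda>j. f $ j $ i))"

text \<open>\<open>f(0,y)\<close>\<close>

definition fps_at_x0 :: "'a fps fps \<Rightarrow> 'a fps" where
  "fps_at_x0 f = Abs_fps (\<lambda>j. f $ j $ 0)"

text \<open>
  \<open>subdegree 0 = 0\<close>, so the first conjunct of the following definition excludes \<open>f(0,y) = 0\<close>.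
\<close>

definition is_weierstrass_poly :: "'a::comm_ring_1 fps fps \<Rightarrow> 'a fps poly \<Rightarrow> bool" where
  "is_weierstrass_poly f F \<longleftrightarrow>
     subdegree (fps_at_x0 f) > 0 \<and>
     lead_coeff F = 1 \<and> degree F = subdegree (fps_at_x0 f) \<and>
     (\<exists>\<epsilon>. \<epsilon> dvd 1 \<and> f = \<epsilon> * fps_of_poly F)"

definition newton_puiseux_x :: "'a::comm_ring_1 fps fps \<Rightarrow> 'a puiseux set" where
  "newton_puiseux_x f =
     {\<psi>. \<exists>F. is_weierstrass_poly f F \<and> poly (map_poly (puiseux_of_fps 1) F) \<psi> = 0}"

definition newton_puiseux_y :: "'a::comm_ring_1 fps fps \<Rightarrow> 'a puiseux set" where
  "newton_puiseux_y f = newton_puiseux_x (fps_swap f)"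


section \<open>Duality and corresponding series\<close>

definition fps_dual :: "'a::field fps \<Rightarrow> 'a fps" where
  "fps_dual \<phi> = (THE \<phi>'. \<phi>' $ 0 \<noteq> 0 \<and>
     (fps_X * \<phi>') oo (fps_X * \<phi>) = fps_X \<and> (fps_X * \<phi>) oo (fps_X * \<phi>') = fps_X)"

text \<open>
  The series \<open>\<eta>~\<close> with constant term \<open>a\<close> such that \<open>\<eta>(t) = (t \<eta>~(t))\<^sup>m\<close>.
\<close>

definition reduced_root :: "nat \<Rightarrow> 'a::field \<Rightarrow> 'a fps \<Rightarrow> 'a fps" where
  "reduced_root m a \<eta> = (THE g. g $ 0 = a \<and> \<eta> = (fps_X * g) ^ m)"

definition corresponding_series :: "nat \<Rightarrow> nat \<Rightarrow> 'a::field \<Rightarrow> 'a fps \<Rightarrow> 'a fps" where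
  "corresponding_series m n a \<eta> = (fps_X * fps_dual (reduced_root m a \<eta>)) ^ n"

end

theory Submission
  imports Defs
begin

text \<open>
  Write \<open>\<eta>(t) = \<sigma>(t)\<^sup>m\<close> with \<open>\<sigma>\<close> of order 1, and let \<open>\<tau>\<close> be the compositional inverse of \<open>\<sigma>\<close>, so that
  \<open>\<xi> = \<tau>\<^sup>n\<close>. The Newton-Puiseux series of \<open>f\<close> gives the parametrization \<open>f(t\<^sup>n, \<eta>(t)) = 0\<close>, and substituting
  \<open>t = \<tau>(u)\<close> turns it into \<open>f(\<xi>(u), u\<^sup>m) = 0\<close>; as \<open>f(x,0) \<noteq> 0\<close> by irreducibility, \<open>f\<close> is a unit times a
  Weierstrass polynomial relative to \<open>y\<close>, which therefore has the root \<open>\<xi>(y\<^bsup>1/m\<^esup>)\<close>. The coefficients of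
  \<open>\<tau>\<^sup>n\<close> are given by Lagrange inversion from \<open>(\<sigma>(t)/t)\<^bsup>-q\<^esup> = a\<^bsup>-q\<^esup> (1 + S)\<^bsup>-q/m\<^esup>\<close>.
\<close>

subsection \<open>Weierstrass preparation\<close>

lemma fps_swap_nth [simp]: "fps_swap f $ i $ j = f $ j $ i"
  by (simp add: fps_swap_def)

lemma fps_swap_swap [simp]: "fps_swap (fps_swap f) = f"
  by (simp add: fps_eq_iff)

lemma fps_swap_mult: "fps_swap (f * g) = fps_swap f * fps_swap (g :: 'a::comm_ring_1 fps fps)"
  unfolding fps_eq_iff fps_swap_nth fps_mult_nth fps_sum_nth by (intro allI sum.swap)

lemma fps_fps_dvd_1_iff:
  fixes f :: "'a::field fps fps"
  shows "f dvd 1 \<longleftrightarrow> f $ 0 $ 0 \<noteq> 0"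
proof -
  have "f dvd 1 \<longleftrightarrow> f $ 0 dvd 1"
    using fps_is_left_unit_iff_zeroth_is_left_unit[of f] by (simp add: dvd_def)
  thus ?thesis by simp
qed

text \<open>
  Coefficients \<open>q\<^sub>i \<in> K[[y]]\<close> of the unit \<open>q \<in> K[[y]][[x]]\<close> for which \<open>q H\<close> is a polynomial in \<open>y\<close>,
  where \<open>H\<^sub>0 = y\<^sup>N u\<close>: the coefficient of \<open>x\<^sup>i\<close> in \<open>q H\<close> is \<open>y\<^sup>N u q\<^sub>i\<close> plus terms in \<open>q\<^sub>l\<close> with \<open>l < i\<close>,
  and \<open>q\<^sub>i\<close> is chosen to cancel everything of degree at least \<open>N\<close>.
\<close>

fun weierstrass_quot :: "nat \<Rightarrow> 'a::field fps \<Rightarrow> 'a fps fps \<Rightarrow> nat \<Rightarrow> 'a fps" where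
  "weierstrass_quot N u H 0 = inverse u"
| "weierstrass_quot N u H (Suc i) =
     - inverse u * fps_shift N (\<Sum>l\<in>{0..i}. weierstrass_quot N u H l * H $ (Suc i - l))"

text \<open>Multiplying \<open>fps_swap f\<close> by the unit \<open>Q\<close> turns its coefficient
  of x^0 into y^N and cuts all later ones to degree below N. Read as a series in y again, the
  product is a monic polynomial of degree N; the inverse of \<open>fps_swap Q\<close> is the
  required unit.\<close>

lemma weierstrass_preparation:
  fixes f :: "'a::field fps fps"
  assumes "subdegree (fps_at_x0 f) > 0"
  shows "\<exists>F. is_weierstrass_poly f F"
proof -
  define N where "N = subdegree (fps_at_x0 f)"
  define H where "H = fps_swap f"
  have H0: "H $ 0 = fps_at_x0 f" by (simp add: fps_eq_iff H_def fps_at_x0_def)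
  define u where "u = fps_shift N (H $ 0)"
  have nz: "H $ 0 \<noteq> 0" using assms by (auto simp: H0)
  have Hu: "H $ 0 = u * fps_X ^ N"
    unfolding u_def N_def H0[symmetric] by (simp add: subdegree_decompose[symmetric])
  have u0: "u $ 0 \<noteq> 0" using nz by (simp add: u_def N_def H0[symmetric])
  define Q where "Q = Abs_fps (weierstrass_quot N u H)"
  define G where "G = fps_swap (Q * H)"
  have QH0: "(Q * H) $ 0 = fps_X ^ N"
    using inverse_mult_eq_1[OF u0] by (simp add: Q_def Hu mult.assoc[symmetric])
  have QHS: "fps_shift N ((Q * H) $ Suc i) = 0" for i
  proof -
    have "(Q * H) $ Suc i = (\<Sum>l\<in>{0..i}. Q $ l * H $ (Suc i - l)) + Q $ Suc i * (u * fps_X ^ N)"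
      by (simp add: fps_mult_nth Hu)
    also have "fps_shift N \<dots> = fps_shift N (\<Sum>l\<in>{0..i}. Q $ l * H $ (Suc i - l)) + Q $ Suc i * u"
      by (simp add: fps_shift_add mult.assoc[symmetric])
    also have "Q $ Suc i * u = - fps_shift N (\<Sum>l\<in>{0..i}. Q $ l * H $ (Suc i - l)) * (inverse u * u)"
      by (simp add: Q_def mult_ac)
    finally show ?thesis using inverse_mult_eq_1[OF u0] by simp
  qed
  have G: "G $ j = (if j = N then 1 else 0)" if "j \<ge> N" for j
  proof (rule fps_ext)
    fix i
    have "(Q * H) $ Suc i $ j = fps_shift N ((Q * H) $ Suc i) $ (j - N)" for i
      unfolding fps_shift_nth using that by simp
    hence "(Q * H) $ Suc i $ j = 0" for i unfolding QHS by simp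
    thus "G $ j $ i = (if j = N then 1 else 0) $ i"
      using QH0 by (cases i) (simp_all add: G_def)
  qed
  define F where "F = (\<Sum>j\<le>N. monom (G $ j) j)"
  have cF: "coeff F j = G $ j" for j
    using G[of j] by (auto simp: F_def coeff_sum)
  have deg: "degree F = N"
    by (rule antisym[OF degree_le le_degree]) (auto simp: cF G)
  have "lead_coeff F = 1" by (simp add: deg cF G)
  have GF: "G = fps_of_poly F" by (simp add: fps_eq_iff cF)
  have "fps_swap Q dvd 1" using u0 by (simp add: fps_fps_dvd_1_iff Q_def)
  then obtain \<epsilon> where \<epsilon>: "1 = fps_swap Q * \<epsilon>" by (auto simp: dvd_def)
  have "f = (fps_swap Q * \<epsilon>) * f" by (simp add: \<epsilon>[symmetric])
  also have "\<dots> = \<epsilon> * fps_of_poly F"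
    by (simp add: GF[symmetric] G_def fps_swap_mult H_def mult_ac)
  finally have "f = \<epsilon> * fps_of_poly F" .
  moreover have "\<epsilon> dvd 1" using \<epsilon> by (metis dvd_triv_right)
  ultimately show ?thesis
    unfolding is_weierstrass_poly_def using assms deg \<open>lead_coeff F = 1\<close> unfolding N_def by blast
qed


subsection \<open>Substitution into a series in two variables\<close>

text \<open>\<open>f(p, q)\<close>; meaningful only if \<open>p\<close> and \<open>q\<close> have zero constant term.\<close>

definition fps_subst2 :: "'a::idom fps fps \<Rightarrow> 'a fps \<Rightarrow> 'a fps \<Rightarrow> 'a fps" where
  "fps_subst2 f p q = Abs_fps (\<lambda>k. \<Sum>j\<le>k. ((f $ j oo p) * q ^ j) $ k)"

lemma fps_mult_power_nth_eq_0:
  fixes q :: "'a::idom fps"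
  assumes "q $ 0 = 0" "k < j"
  shows "(a * q ^ j) $ k = 0"
  using assms by (auto simp: fps_mult_nth startsby_zero_power_prefix intro!: sum.neutral)

text \<open>Since q^j has order at least j, every cut-off K from k on gives the same coefficient, so
  a whole range of coefficients can be read off one finite sum of series.\<close>

lemma fps_subst2_nth:
  assumes "q $ 0 = 0" "k \<le> K"
  shows "fps_subst2 f p q $ k = (\<Sum>j\<le>K. (f $ j oo p) * q ^ j) $ k"
proof -
  have "(\<Sum>j\<le>K. ((f $ j oo p) * q ^ j) $ k) = (\<Sum>j\<le>k. ((f $ j oo p) * q ^ j) $ k)"
    by (rule sum.mono_neutral_right) (use assms in \<open>auto intro!: fps_mult_power_nth_eq_0\<close>)
  thus ?thesis by (simp add: fps_subst2_def fps_sum_nth)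
qed

lemma fps_subst2_nth_0 [simp]: "fps_subst2 f p q $ 0 = f $ 0 $ 0"
  by (simp add: fps_subst2_def)

lemma fps_subst2_mult:
  fixes f g :: "'a::idom fps fps"
  assumes p: "p $ 0 = 0" and q: "q $ 0 = 0"
  shows "fps_subst2 (f * g) p q = fps_subst2 f p q * fps_subst2 g p q"
proof (rule fps_ext)
  fix k
  define A where "A = (\<lambda>j. (f $ j oo p) * q ^ j)"
  define B where "B = (\<lambda>j. (g $ j oo p) * q ^ j)"
  have AB: "A j $ l = 0" "B j $ l = 0" if "l < j" for j l
    using that q by (auto simp: A_def B_def fps_mult_power_nth_eq_0)
  have conv: "((f * g) $ j oo p) * q ^ j = (\<Sum>i\<le>j. A i * B (j - i))" for j
  proof -
    have "((f * g) $ j oo p) * q ^ j = (\<Sum>i\<le>j. (f $ i oo p) * (g $ (j - i) oo p) * q ^ j)"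
      by (simp add: fps_mult_nth fps_compose_sum_distrib fps_compose_mult_distrib[OF p]
          sum_distrib_right atLeast0AtMost)
    also have "\<dots> = (\<Sum>i\<le>j. A i * B (j - i))"
    proof (rule sum.cong)
      fix i assume "i \<in> {..j}"
      hence "q ^ j = q ^ i * q ^ (j - i)" by (simp add: power_add[symmetric])
      thus "(f $ i oo p) * (g $ (j - i) oo p) * q ^ j = A i * B (j - i)"
        by (simp add: A_def B_def mult_ac)
    qed simp
    finally show ?thesis .
  qed
  \<comment> \<open>Both \<open>A i\<close> and \<open>B i\<close> have order at least i, so for
    fixed l the triangle i + j \<le> k contributes only through the rectangle i \<le> l, j \<le> k -
    l.\<close>
  have "(\<Sum>i\<le>k. \<Sum>j\<le>k-i. A i $ l * B j $ (k - l)) = (\<Sum>i\<le>l. A i $ l) * (\<Sum>j\<le>k-l. B j $ (k - l))"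
    if "l \<le> k" for l
  proof -
    have "(\<Sum>i\<le>k. \<Sum>j\<le>k-i. A i $ l * B j $ (k - l)) = (\<Sum>i\<le>l. \<Sum>j\<le>k-i. A i $ l * B j $ (k - l))"
      by (rule sum.mono_neutral_right) (use that in \<open>auto simp: AB\<close>)
    also have "\<dots> = (\<Sum>i\<le>l. \<Sum>j\<le>k-l. A i $ l * B j $ (k - l))"
      by (intro sum.cong refl sum.mono_neutral_right) (use that in \<open>auto simp: AB\<close>)
    finally show ?thesis by (simp add: sum_product)
  qed
  note inner = this
  have "fps_subst2 (f * g) p q $ k = (\<Sum>j\<le>k. \<Sum>i\<le>j. (A i * B (j - i)) $ k)"
    by (simp add: fps_subst2_def conv fps_sum_nth del: fps_mult_nth)
  also have "\<dots> = (\<Sum>i\<le>k. \<Sum>j\<le>k-i. (A i * B j) $ k)"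
    unfolding sum.triangle_reindex_eq[of "\<lambda>i j. (A i * B j) $ k", symmetric]
    by (subst sum.Sigma) (auto intro!: sum.cong)
  also have "\<dots> = (\<Sum>i\<le>k. \<Sum>j\<le>k-i. \<Sum>l\<le>k. A i $ l * B j $ (k - l))"
    by (simp add: fps_mult_nth atLeast0AtMost)
  also have "\<dots> = (\<Sum>l\<le>k. \<Sum>i\<le>k. \<Sum>j\<le>k-i. A i $ l * B j $ (k - l))"
    by (subst sum.swap, subst (2) sum.swap, rule refl)
  also have "\<dots> = (\<Sum>l\<le>k. (\<Sum>i\<le>l. A i $ l) * (\<Sum>j\<le>k-l. B j $ (k - l)))"
    by (intro sum.cong refl inner) simp
  also have "\<dots> = (fps_subst2 f p q * fps_subst2 g p q) $ k"
    by (simp add: fps_mult_nth fps_subst2_def A_def B_def atLeast0AtMost)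
  finally show "fps_subst2 (f * g) p q $ k = (fps_subst2 f p q * fps_subst2 g p q) $ k" .
qed

lemma fps_subst2_of_poly:
  assumes "q $ 0 = 0"
  shows "fps_subst2 (fps_of_poly F) p q = poly (map_poly (\<lambda>a. a oo p) F) q"
proof (rule fps_ext)
  fix k
  let ?F = "map_poly (\<lambda>a. a oo p) F"
  have "fps_subst2 (fps_of_poly F) p q $ k = (\<Sum>j\<le>max k (degree F). (coeff F j oo p) * q ^ j) $ k"
    by (subst fps_subst2_nth[OF assms, of k "max k (degree F)"]) simp_all
  also have "(\<Sum>j\<le>max k (degree F). (coeff F j oo p) * q ^ j) = (\<Sum>j\<le>degree F. (coeff F j oo p) * q ^ j)"
    by (rule sum.mono_neutral_right) (auto simp: coeff_eq_0)
  also have "\<dots> = (\<Sum>j\<le>degree F. coeff ?F j * q ^ j)"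
    by (simp add: coeff_map_poly)
  also have "\<dots> = (\<Sum>j\<le>degree ?F. coeff ?F j * q ^ j)"
    by (rule sum.mono_neutral_right) (auto simp: coeff_eq_0 map_poly_degree_leq)
  finally show "fps_subst2 (fps_of_poly F) p q $ k = poly ?F q $ k"
    by (simp add: poly_altdef)
qed

lemma fps_subst2_fps_X [simp]: "q $ 0 = 0 \<Longrightarrow> fps_subst2 fps_X p q = q"
  using fps_subst2_of_poly[of q "[:0, 1:]" p] by (simp add: map_poly_pCons)

lemma fps_subst2_compose:
  assumes p: "p $ 0 = 0" and q: "q $ 0 = 0" and \<tau>: "\<tau> $ 0 = 0"
  shows "fps_subst2 f p q oo \<tau> = fps_subst2 f (p oo \<tau>) (q oo \<tau>)"
proof (rule fps_ext)
  fix k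
  have "(fps_subst2 f p q oo \<tau>) $ k = ((\<Sum>j\<le>k. (f $ j oo p) * q ^ j) oo \<tau>) $ k"
    by (simp add: fps_compose_nth fps_subst2_nth[OF q, of _ k])
  also have "(\<Sum>j\<le>k. (f $ j oo p) * q ^ j) oo \<tau> = (\<Sum>j\<le>k. (f $ j oo (p oo \<tau>)) * (q oo \<tau>) ^ j)"
    by (simp add: fps_compose_sum_distrib fps_compose_mult_distrib[OF \<tau>] fps_compose_power[OF \<tau>]
        fps_compose_assoc[OF \<tau> p])
  also have "\<dots> $ k = fps_subst2 f (p oo \<tau>) (q oo \<tau>) $ k"
    by (rule fps_subst2_nth[symmetric]) (simp_all add: q)
  finally show "(fps_subst2 f p q oo \<tau>) $ k = fps_subst2 f (p oo \<tau>) (q oo \<tau>) $ k" .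
qed

text \<open>Expanding the inner composition as well treats p and q alike; exchanging the variables
  then amounts to exchanging two finite sums.\<close>

lemma fps_subst2_nth_symmetric:
  assumes p: "p $ 0 = 0"
  shows "fps_subst2 f p q $ k = (\<Sum>j\<le>k. \<Sum>i\<le>k. f $ j $ i * (p ^ i * q ^ j) $ k)"
  unfolding fps_subst2_def fps_nth_Abs_fps
proof (rule sum.cong[OF refl])
  fix j
  have "(f $ j oo p) $ l = (\<Sum>i\<le>k. f $ j $ i * p ^ i $ l)" if "l \<le> k" for l
    unfolding fps_compose_nth
    by (rule sum.mono_neutral_left) (use that in \<open>auto simp: startsby_zero_power_prefix[OF p]\<close>)
  hence "((f $ j oo p) * q ^ j) $ k = (\<Sum>l\<le>k. \<Sum>i\<le>k. f $ j $ i * p ^ i $ l * q ^ j $ (k - l))"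
    by (simp add: fps_mult_nth[of "f $ j oo p"] atLeast0AtMost sum_distrib_right)
  also have "\<dots> = (\<Sum>i\<le>k. f $ j $ i * (p ^ i * q ^ j) $ k)"
    by (subst sum.swap) (simp add: fps_mult_nth atLeast0AtMost sum_distrib_left mult_ac)
  finally show "((f $ j oo p) * q ^ j) $ k = (\<Sum>i\<le>k. f $ j $ i * (p ^ i * q ^ j) $ k)" .
qed

lemma fps_subst2_swap:
  assumes "p $ 0 = 0" "q $ 0 = 0"
  shows "fps_subst2 (fps_swap f) q p = fps_subst2 f p q"
  by (rule fps_ext, simp add: fps_subst2_nth_symmetric assms, subst sum.swap)
     (simp add: mult.commute)


subsection \<open>Newton-Puiseux series as parametrizations\<close>

lemma puiseux_of_fps_eq_0_iff:
  assumes "n > 0"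
  shows "puiseux_of_fps n a = (0 :: 'a::comm_ring_1 puiseux) \<longleftrightarrow> a = 0"
proof
  assume "puiseux_of_fps n a = 0"
  hence "puiseux_nth (puiseux_of_fps n a) (of_nat i / of_nat n)
      = puiseux_nth (puiseux_of_fps n (0 :: 'a fps)) (of_nat i / of_nat n)" for i
    using assms by (simp add: puiseux_of_fps_0)
  thus "a = 0" by (simp add: fps_eq_iff puiseux_nth_of_fps_frac[OF assms])
qed (use assms in \<open>simp add: puiseux_of_fps_0\<close>)

lemma puiseux_of_fps_compose_fps_X_power:
  assumes n: "n > 0"
  shows "puiseux_of_fps n (a oo fps_X ^ n) = puiseux_of_fps 1 (a :: 'a::comm_ring_1 fps)"
proof (rule puiseux_eqI)
  fix r :: rat
  show "puiseux_nth (puiseux_of_fps n (a oo fps_X ^ n)) r = puiseux_nth (puiseux_of_fps 1 a) r"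
  proof (cases "of_nat n * r \<in> \<nat>")
    case True
    then obtain i where i: "of_nat n * r = of_nat i" by (auto simp: Nats_def)
    hence r: "r = of_nat i / of_nat n" using n by (simp add: field_simps)
    have "r \<in> \<nat> \<longleftrightarrow> n dvd i"
    proof
      assume "r \<in> \<nat>"
      then obtain j where "r = of_nat j" by (auto simp: Nats_def)
      hence "(of_nat i :: rat) = of_nat (n * j)" using i by simp
      thus "n dvd i" unfolding of_nat_eq_iff by simp
    qed (use n r in \<open>auto simp: Nats_def\<close>)
    moreover have "nat \<lfloor>r\<rfloor> = i div n" by (simp add: r floor_divide_of_nat_eq)
    ultimately show ?thesis
      using n by (simp add: puiseux_nth_of_fps i fps_nth_compose_X_power)
  next
    case False
    moreover have "r \<notin> \<nat>" using False Nats_mult of_nat_in_Nats by blast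
    ultimately show ?thesis using n by (simp add: puiseux_nth_of_fps)
  qed
qed

text \<open>In the common variable t = x^(1/n) a coefficient a(x) becomes a(t^n), so the evaluation
  can be carried out on power series in t.\<close>

lemma poly_puiseux_of_fps:
  fixes F :: "'a::idom fps poly"
  assumes n: "n > 0"
  shows "poly (map_poly (puiseux_of_fps 1) F) (puiseux_of_fps n b) =
           puiseux_of_fps n (poly (map_poly (\<lambda>a. a oo fps_X ^ n) F) b)"
proof (induction F)
  case 0
  thus ?case using n by (simp add: puiseux_of_fps_0)
next
  case (pCons a F)
  thus ?case using n
    by (simp add: map_poly_pCons puiseux_of_fps_0 puiseux_of_fps_hom
        puiseux_of_fps_compose_fps_X_power[OF n, symmetric] del: One_nat_def)
qed

lemma newton_puiseux_x_subst2:
  fixes f :: "'a::idom fps fps"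
  assumes n: "n > 0" and b: "b $ 0 = 0" and "puiseux_of_fps n b \<in> newton_puiseux_x f"
  shows "fps_subst2 f (fps_X ^ n) b = 0"
proof -
  obtain F \<epsilon> where "f = \<epsilon> * fps_of_poly F"
    and "poly (map_poly (puiseux_of_fps 1) F) (puiseux_of_fps n b) = 0"
    using assms(3) by (auto simp: newton_puiseux_x_def is_weierstrass_poly_def)
  thus ?thesis
    using n b by (simp add: fps_subst2_mult fps_subst2_of_poly poly_puiseux_of_fps
        puiseux_of_fps_eq_0_iff del: One_nat_def)
qed

text \<open>The unit of the Weierstrass factorisation keeps a non-zero constant term under
  substitution and cancels in the domain of power series, which leaves a root of
  \<open>F\<close>.\<close>

lemma newton_puiseux_xI:
  fixes f :: "'a::field fps fps"
  assumes n: "n > 0" and b: "b $ 0 = 0"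
    and sub: "subdegree (fps_at_x0 f) > 0" and root: "fps_subst2 f (fps_X ^ n) b = 0"
  shows "puiseux_of_fps n b \<in> newton_puiseux_x f"
proof -
  obtain F where F: "is_weierstrass_poly f F" using weierstrass_preparation[OF sub] by blast
  then obtain \<epsilon> where \<epsilon>: "\<epsilon> dvd 1" "f = \<epsilon> * fps_of_poly F"
    by (auto simp: is_weierstrass_poly_def)
  have "fps_subst2 \<epsilon> (fps_X ^ n) b $ 0 \<noteq> 0" using \<epsilon>(1) by (simp add: fps_fps_dvd_1_iff)
  hence "fps_subst2 \<epsilon> (fps_X ^ n) b \<noteq> 0" by (rule fps_nonzeroI)
  hence "poly (map_poly (\<lambda>a. a oo fps_X ^ n) F) b = 0"
    using root n b by (simp add: \<epsilon>(2) fps_subst2_mult fps_subst2_of_poly)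
  thus ?thesis
    using F n by (auto simp: newton_puiseux_x_def poly_puiseux_of_fps puiseux_of_fps_0 simp del: One_nat_def)
qed

text \<open>If f(x,0) = 0, then y divides f and irreducibility makes the cofactor a unit;
  substitution then yields q times a unit, which is not zero.\<close>

lemma irreducible_at_y0_nonzero:
  fixes f :: "'a::field fps fps"
  assumes irr: "irreducible f" and p: "p $ 0 = 0" and q: "q $ 0 = 0" "q \<noteq> 0"
    and root: "fps_subst2 f p q = 0"
  shows "f $ 0 \<noteq> 0"
proof
  assume "f $ 0 = 0"
  hence f: "f = fps_X * fps_shift 1 f" by (simp add: fps_eq_iff)
  have "\<not> fps_X dvd (1 :: 'a fps fps)" by (simp add: fps_fps_dvd_1_iff)
  with irreducibleD[OF irr f] have "fps_shift 1 f $ 0 $ 0 \<noteq> 0"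
    by (simp add: fps_fps_dvd_1_iff)
  hence "fps_subst2 (fps_shift 1 f) p q $ 0 \<noteq> 0" by simp
  hence "fps_subst2 (fps_shift 1 f) p q \<noteq> 0" by (rule fps_nonzeroI)
  moreover have "fps_subst2 f p q = q * fps_subst2 (fps_shift 1 f) p q"
    by (subst f, subst fps_subst2_mult) (use p q in auto)
  ultimately show False using root q by simp
qed


subsection \<open>Dual and corresponding series\<close>

text \<open>The witness is the compositional inverse of \<sigma> divided by the variable; it is
  unique because right composition with a series of order 1 is injective.\<close>

lemma fps_dual_inverse:
  fixes \<phi> :: "'a::field fps"
  assumes "\<phi> $ 0 \<noteq> 0"
  shows "(fps_X * fps_dual \<phi>) oo (fps_X * \<phi>) = fps_X"
    and "(fps_X * \<phi>) oo (fps_X * fps_dual \<phi>) = fps_X"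
proof -
  define \<sigma> where "\<sigma> = fps_X * \<phi>"
  have s: "\<sigma> $ 0 = 0" "\<sigma> $ 1 \<noteq> 0" using assms by (simp_all add: \<sigma>_def)
  define P where "P = (\<lambda>\<psi>. \<psi> $ 0 \<noteq> 0 \<and> (fps_X * \<psi>) oo \<sigma> = fps_X \<and> \<sigma> oo (fps_X * \<psi>) = fps_X)"
  define \<psi> where "\<psi> = fps_shift 1 (fps_inv \<sigma>)"
  have X: "fps_X * \<psi> = fps_inv \<sigma>"
    by (simp add: \<psi>_def fps_eq_iff fps_inv_def)
  have "\<psi> $ 0 \<noteq> 0" using s(2) by (simp add: \<psi>_def fps_inv_def)
  hence "P \<psi>" unfolding P_def X using fps_inv[OF s] fps_inv_right[OF s] by blast
  moreover have "\<psi>' = \<psi>" if "P \<psi>'" for \<psi>'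
  proof -
    have "fps_X * \<psi>' = fps_X * \<psi>"
      using that \<open>P \<psi>\<close> fps_compose_inj_right[OF s] unfolding P_def by metis
    thus ?thesis by simp
  qed
  ultimately have "P (THE \<psi>. P \<psi>)" by (rule theI)
  thus "(fps_X * fps_dual \<phi>) oo (fps_X * \<phi>) = fps_X"
    and "(fps_X * \<phi>) oo (fps_X * fps_dual \<phi>) = fps_X"
    unfolding P_def fps_dual_def \<sigma>_def by auto
qed

text \<open>The root is a (1 + S)^(1/m) by the binomial series. Series with equal m-th powers and
  the same non-zero constant term coincide.\<close>

lemma reduced_root_eq:
  fixes S :: "'a::field_char_0 fps"
  assumes m: "m > 0" and a: "a \<noteq> 0" and S: "S $ 0 = 0"
  shows "reduced_root m a (fps_const (a ^ m) * fps_X ^ m * (1 + S)) =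
           fps_const a * (fps_binomial (1 / of_nat m) oo S)"
    and "fps_const (a ^ m) * fps_X ^ m * (1 + S) =
           (fps_X * (fps_const a * (fps_binomial (1 / of_nat m) oo S))) ^ m"
proof -
  let ?\<eta> = "fps_const (a ^ m) * fps_X ^ m * (1 + S)"
  let ?g = "fps_const a * (fps_binomial (1 / of_nat m) oo S)"
  have "(fps_binomial (1 / of_nat m) oo S) ^ m = 1 + S"
    using m S by (simp add: fps_compose_power fps_binomial_power fps_binomial_1
        fps_compose_add_distrib)
  thus eq: "?\<eta> = (fps_X * ?g) ^ m"
    by (simp add: power_mult_distrib mult_ac fps_const_power)
  show "reduced_root m a ?\<eta> = ?g"
    unfolding reduced_root_def
  proof (rule the_equality)
    fix g assume g: "g $ 0 = a \<and> ?\<eta> = (fps_X * g) ^ m"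
    hence "fps_X ^ m * g ^ m = fps_X ^ m * ?g ^ m"
      using eq by (simp add: power_mult_distrib)
    hence "g ^ m = ?g ^ m" by simp
    thus "g = ?g" by (rule fps_power_eqD) (use g a m in auto)
  qed (use eq in simp)
qed


subsection \<open>Lagrange inversion\<close>

text \<open>
  The coefficient of \<open>t\<^bsup>q-1\<^esup>\<close> in \<open>\<sigma>\<^sup>j g\<^bsup>-q\<^esup> \<sigma>'\<close> is the residue of \<open>\<sigma>\<^bsup>j-q\<^esup> d\<sigma>\<close> for \<open>\<sigma> = t g\<close>: for \<open>j < q - 1\<close> this
  form is exact.
\<close>

lemma residue_power_deriv:
  fixes g :: "'a::field_char_0 fps"
  assumes g: "g $ 0 \<noteq> 0" and j: "j < q"
  shows "((fps_X * g) ^ j * (inverse g ^ q * fps_deriv (fps_X * g))) $ (q - 1) =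
           (if j = q - 1 then 1 else 0)"
proof -
  have gi: "g * inverse g = 1" using inverse_mult_eq_1'[OF g] .
  \<comment> \<open>The form is \<sigma>^(-1-k) d\<sigma>: for k = 0 it is logarithmic with residue
    1, for k > 0 it is exact.\<close>
  define k where "k = q - 1 - j"
  have q: "q = j + Suc k" using j by (simp add: k_def)
  define h where "h = inverse g ^ k"
  have "(fps_X * g) ^ j * (inverse g ^ q * fps_deriv (fps_X * g)) =
          fps_X ^ j * ((g * inverse g) ^ j * (h * (g * inverse g) + inverse g * h * (fps_X * fps_deriv g)))"
    by (simp add: q h_def power_add power_mult_distrib algebra_simps)
  also have "\<dots> = fps_X ^ j * (h + inverse g * h * (fps_X * fps_deriv g))"
    by (simp add: gi)
  finally have "((fps_X * g) ^ j * (inverse g ^ q * fps_deriv (fps_X * g))) $ (q - 1)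
      = (h + inverse g * h * (fps_X * fps_deriv g)) $ k"
    by (simp add: q fps_X_power_mult_nth)
  also have "\<dots> = (if k = 0 then 1 else 0)"
  proof (cases "k = 0")
    case True
    thus ?thesis by (simp add: h_def)
  next
    case False
    have dh: "fps_deriv h = - (of_nat k * (inverse g * h * fps_deriv g))"
    proof -
      have "inverse g ^ (k - 1) * (inverse g)\<^sup>2 = inverse g * h"
        using False by (cases k) (simp_all add: h_def power2_eq_square mult_ac)
      moreover have "fps_deriv h = - (of_nat k * fps_deriv g * (inverse g ^ (k - 1) * (inverse g)\<^sup>2))"
        by (simp add: h_def fps_deriv_power' fps_inverse_deriv[OF g] mult_ac)
      ultimately show ?thesis by (simp add: mult_ac)
    qed
    \<comment> \<open>The operator k - t d/dt kills the coefficient of t^k; the factor k is then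
      cancelled in characteristic zero.\<close>
    have "of_nat k * (h + inverse g * h * (fps_X * fps_deriv g)) = of_nat k * h - fps_X * fps_deriv h"
      unfolding dh by (simp add: algebra_simps)
    moreover have "(of_nat k * h - fps_X * fps_deriv h) $ k = 0"
      using False by (simp add: fps_of_nat[symmetric])
    ultimately have "(of_nat k * (h + inverse g * h * (fps_X * fps_deriv g))) $ k = 0" by simp
    thus ?thesis using False by (simp add: fps_of_nat[symmetric])
  qed
  finally show ?thesis using j by (auto simp: k_def)
qed

text \<open>Differentiate \<tau>^n(\<sigma>(t)) = t^n, multiply by g^(-q) and compare coefficients
  of t^(q-1). With the derivative of \<tau>^n expanded in powers of \<sigma>,
  \<open>residue_power_deriv\<close> keeps only its coefficient of index q - 1, which is q times
  that of \<tau>^n at q.\<close>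

lemma lagrange_inversion:
  fixes g \<tau> :: "'a::field_char_0 fps"
  assumes g: "g $ 0 \<noteq> 0" and \<tau>: "\<tau> $ 0 = 0" "\<tau> oo (fps_X * g) = fps_X"
    and n: "n > 0" and q: "q \<ge> n"
  shows "(\<tau> ^ n) $ q = of_nat n / of_nat q * (inverse g ^ q) $ (q - n)"
proof -
  define \<sigma> where "\<sigma> = fps_X * g"
  have s0: "\<sigma> $ 0 = 0" by (simp add: \<sigma>_def)
  define W where "W = inverse g ^ q * fps_deriv \<sigma>"
  define B where "B = fps_deriv (\<tau> ^ n)"
  have q0: "q > 0" using n q by simp
  have "\<tau> oo \<sigma> = fps_X" using \<tau>(2) by (simp add: \<sigma>_def)
  hence "\<tau> ^ n oo \<sigma> = fps_X ^ n"
    by (simp add: fps_compose_power[OF s0, symmetric])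
  hence "fps_deriv (\<tau> ^ n oo \<sigma>) = fps_deriv (fps_X ^ n)" by simp
  hence "(B oo \<sigma>) * fps_deriv \<sigma> = of_nat n * fps_X ^ (n - 1)"
    by (simp add: fps_compose_deriv[OF s0] B_def fps_deriv_power')
  hence "(B oo \<sigma>) * W = of_nat n * (fps_X ^ (n - 1) * inverse g ^ q)"
    by (simp add: W_def mult_ac)
  hence "((B oo \<sigma>) * W) $ (q - 1) = of_nat n * (inverse g ^ q) $ (q - n)"
    using n q by (simp add: fps_of_nat[symmetric] fps_X_power_mult_nth mult.assoc)
  moreover have "((B oo \<sigma>) * W) $ (q - 1) = of_nat q * (\<tau> ^ n) $ q"
  proof -
    have B: "(B oo \<sigma>) $ l = (\<Sum>j<q. B $ j * \<sigma> ^ j $ l)" if "l < q" for l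
      unfolding fps_compose_nth
      by (rule sum.mono_neutral_left) (use that in \<open>auto simp: startsby_zero_power_prefix[OF s0]\<close>)
    have "((B oo \<sigma>) * W) $ (q - 1) = (\<Sum>l=0..q-1. \<Sum>j<q. B $ j * \<sigma> ^ j $ l * W $ (q - 1 - l))"
      unfolding fps_mult_nth using q0 by (intro sum.cong refl) (simp add: B sum_distrib_right)
    also have "\<dots> = (\<Sum>j<q. B $ j * (\<sigma> ^ j * W) $ (q - 1))"
      by (subst sum.swap) (simp add: fps_mult_nth sum_distrib_left mult.assoc)
    also have "\<dots> = (\<Sum>j<q. B $ j * (if j = q - 1 then 1 else 0))"
      using residue_power_deriv[OF g] by (intro sum.cong refl) (simp add: \<sigma>_def W_def)
    also have "\<dots> = B $ (q - 1)" using q0 by (simp add: if_distrib cong: if_cong)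
    finally show ?thesis using q0 by (simp add: B_def)
  qed
  ultimately show ?thesis using q0 by (simp add: field_simps)
qed

text \<open>Each coefficient of the partial sums is eventually constant because S has no constant
  term. The index \<open>Suc i\<close> matches a sum over i \<ge> 1; the subtracted 1 is the term of
  index 0.\<close>

lemma fps_binomial_compose_sums_Suc:
  fixes S :: "'a::field_char_0 fps"
  assumes "S $ 0 = 0"
  shows "(\<lambda>i. fps_const (r gchoose Suc i) * S ^ Suc i) sums ((fps_binomial r oo S) - 1)"
  unfolding sums_def
proof (rule tendsto_fpsI)
  fix k
  let ?f = "\<lambda>i. fps_const (r gchoose i) * S ^ i"
  have "(\<Sum>i<N. ?f (Suc i)) $ k = ((fps_binomial r oo S) - 1) $ k" if "N \<ge> k" for N
  proof -
    have "(\<Sum>i<Suc N. ?f i) $ k = (fps_binomial r oo S) $ k"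
      unfolding fps_sum_nth fps_compose_nth fps_mult_left_const_nth fps_binomial_nth
      by (rule sum.mono_neutral_right)
         (use that in \<open>auto simp: startsby_zero_power_prefix[OF assms]\<close>)
    moreover have "(\<Sum>i<N. ?f (Suc i)) = (\<Sum>i<Suc N. ?f i) - 1"
      by (simp add: sum.lessThan_Suc_shift del: sum.lessThan_Suc)
    ultimately show ?thesis by simp
  qed
  thus "\<forall>\<^sub>F N in sequentially.
      (\<Sum>i<N. ?f (Suc i)) $ k = ((fps_binomial r oo S) - 1) $ k"
    by (intro eventually_mono[OF eventually_ge_at_top[of k]])
qed

theorem proposition4p10:
  fixes f :: "'a::{alg_closed_field, field_char_0} fps fps"
    and m n :: nat and a :: 'a and c :: "nat \<Rightarrow> 'a" and S \<eta> \<xi> :: "'a fps"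
  assumes "irreducible f"
    and "m > 0" and "n > 0" and "a \<noteq> 0"
    and "S = Abs_fps (\<lambda>j. if j > 0 then c (m + j) else 0)"
    and "\<eta> = fps_const (a ^ m) * fps_X ^ m * (1 + S)"
    and "puiseux_of_fps n \<eta> \<in> newton_puiseux_x f"
    and "primitive_rep n \<eta>"
    and "\<xi> = corresponding_series m n a \<eta>"
  shows "puiseux_of_fps m \<xi> \<in> newton_puiseux_y f \<and>
    (\<forall>q\<ge>n. puiseux_nth (puiseux_of_fps m \<xi>) (of_nat q / of_nat m) =
       of_nat n / of_nat q * a powi (- int q) *
       puiseux_nth
         (puiseux_of_fps n
           (1 + (\<Sum>i. fps_const ((- of_nat q / of_nat m) gchoose Suc i) * S ^ Suc i)))
         (- 1 + of_nat q / of_nat n))"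
proof (intro conjI allI impI)
  note m = \<open>m > 0\<close> and n = \<open>n > 0\<close> and a = \<open>a \<noteq> 0\<close>
  have S0: "S $ 0 = 0" by (simp add: assms(5))
  define g where "g = reduced_root m a \<eta>"
  have g: "g = fps_const a * (fps_binomial (1 / of_nat m) oo S)" and \<eta>: "\<eta> = (fps_X * g) ^ m"
    using reduced_root_eq[OF m a S0] by (simp_all add: g_def assms(6))
  have g0: "g $ 0 \<noteq> 0" using a by (simp add: g)
  define \<tau> where "\<tau> = fps_X * fps_dual g"
  have \<tau>0: "\<tau> $ 0 = 0" by (simp add: \<tau>_def)
  have \<tau>: "\<tau> oo (fps_X * g) = fps_X" "(fps_X * g) oo \<tau> = fps_X"
    unfolding \<tau>_def using fps_dual_inverse[OF g0] by auto
  have \<xi>: "\<xi> = \<tau> ^ n" by (simp add: assms(9) corresponding_series_def \<tau>_def g_def)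
  have \<xi>0: "\<xi> $ 0 = 0" using n by (simp add: \<xi> \<tau>0)
  have \<eta>0: "\<eta> $ 0 = 0" using m by (simp add: \<eta>)
  have "g \<noteq> 0" using g0 by auto
  hence \<eta>nz: "\<eta> \<noteq> 0" by (simp add: \<eta>)
  have root: "fps_subst2 f (fps_X ^ n) \<eta> = 0"
    using newton_puiseux_x_subst2[OF n \<eta>0 assms(7)] .
  have "fps_subst2 f (fps_X ^ n oo \<tau>) (\<eta> oo \<tau>) = 0"
    using n root by (simp add: fps_subst2_compose[symmetric] \<tau>0 \<eta>0)
  moreover have "\<eta> oo \<tau> = fps_X ^ m"
    by (simp add: \<eta> fps_compose_power[OF \<tau>0, symmetric] \<tau>(2))
  moreover have "fps_X ^ n oo \<tau> = \<xi>"
    by (simp add: \<xi> fps_X_power_compose[OF \<tau>0])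
  ultimately have "fps_subst2 (fps_swap f) (fps_X ^ m) \<xi> = 0"
    using m by (simp add: fps_subst2_swap \<xi>0)
  \<comment> \<open>The order of f(x,0) is the Weierstrass degree relative to y. As
    \<open>subdegree 0 = 0\<close>, its positivity needs both f(x,0) \<noteq> 0 and f(0,0) =
    0.\<close>
  moreover have "subdegree (fps_at_x0 (fps_swap f)) > 0"
  proof -
    have "fps_at_x0 (fps_swap f) = f $ 0" by (simp add: fps_eq_iff fps_at_x0_def)
    moreover have "f $ 0 \<noteq> 0"
      using irreducible_at_y0_nonzero[OF assms(1) _ \<eta>0 \<eta>nz root] n by simp
    moreover have "f $ 0 $ 0 = 0"
    proof -
      have "subdegree (fps_at_x0 f) > 0"
        using assms(7) by (auto simp: newton_puiseux_x_def is_weierstrass_poly_def)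
      hence "fps_at_x0 f $ 0 = 0" by (rule nth_less_subdegree_zero)
      thus ?thesis by (simp add: fps_at_x0_def)
    qed
    ultimately show ?thesis using subdegree_eq_0_iff[of "f $ 0"] by auto
  qed
  ultimately show "puiseux_of_fps m \<xi> \<in> newton_puiseux_y f"
    unfolding newton_puiseux_y_def by (intro newton_puiseux_xI m \<xi>0)
  fix q assume q: "q \<ge> n"
  define r :: 'a where "r = - of_nat q / of_nat m"
  have Z: "1 + (\<Sum>i. fps_const (r gchoose Suc i) * S ^ Suc i) = fps_binomial r oo S"
    using fps_binomial_compose_sums_Suc[OF S0, of r] by (simp add: sums_iff)
  \<comment> \<open>The bound q \<ge> n makes the natural subtraction exact, so the exponent selects
    the coefficient of t^(q-n).\<close>
  have e: "(- 1 + of_nat q / of_nat n :: rat) = of_nat (q - n) / of_nat n"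
    using q n by (simp add: of_nat_diff field_simps)
  have "g ^ q = fps_const (a ^ q) * (fps_binomial (- r) oo S)"
    by (simp add: g power_mult_distrib fps_const_power fps_compose_power[OF S0] fps_binomial_power r_def)
  \<comment> \<open>Binomial exponents add, so (1 + S)^(q/m) and (1 + S)^(-q/m) cancel; this yields
    the power g^(-q) for Lagrange inversion.\<close>
  hence "g ^ q * (fps_const (inverse a ^ q) * (fps_binomial r oo S)) =
      fps_const (a ^ q * inverse a ^ q) * (fps_binomial (- r + r) oo S)"
    by (simp only: fps_binomial_add_mult fps_compose_mult_distrib[OF S0] fps_const_mult[symmetric] mult_ac)
  also have "\<dots> = 1" using a by (simp add: power_mult_distrib[symmetric])
  finally have "inverse (g ^ q) = fps_const (inverse a ^ q) * (fps_binomial r oo S)"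
    by (rule fps_inverse_unique)
  hence inv: "inverse g ^ q = fps_const (inverse a ^ q) * (fps_binomial r oo S)"
    by (simp add: fps_inverse_power)
  have "puiseux_nth (puiseux_of_fps m \<xi>) (of_nat q / of_nat m) = (\<tau> ^ n) $ q"
    by (simp only: puiseux_nth_of_fps_frac[OF m] \<xi>)
  also have "\<dots> = of_nat n / of_nat q * (inverse a ^ q * (fps_binomial r oo S) $ (q - n))"
    using lagrange_inversion[OF g0 \<tau>0 \<tau>(1) n q] by (simp add: inv)
  finally show "puiseux_nth (puiseux_of_fps m \<xi>) (of_nat q / of_nat m) =
       of_nat n / of_nat q * a powi (- int q) *
       puiseux_nth
         (puiseux_of_fps n
           (1 + (\<Sum>i. fps_const ((- of_nat q / of_nat m) gchoose Suc i) * S ^ Suc i)))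
         (- 1 + of_nat q / of_nat n)"
    unfolding r_def[symmetric] Z e puiseux_nth_of_fps_frac[OF n]
    by (simp add: power_int_minus power_inverse mult.assoc)
qed

end
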